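(* Let $\mathbb{C}_n$ be the empirical copula of a sample $\boldsymbol{X}_1,\ldots,\boldsymbol{X}_n$ of $d$-variate vectors without ties in any of the $d$ components. Let $\boldsymbol{m}=(m_1,\ldots,m_d)\in\mathbb{N}^d$. The empirical Bernstein copula $B_{\boldsymbol{m}}(\mathbb{C}_n)$ is a copula if and only if all the polynomial degrees $m_1,\ldots,m_d$ are divisors of $n$.
   Context: $\mathbb{N}$ denotes the positive integers. For $\boldsymbol{X}_i=(X_{i,1},\ldots,X_{i,d})$, "without ties in any of the $d$ components" means that for each $j$ the numbers $X_{1,j},\ldots,X_{n,j}$ are pairwise distinct. The ranks are $R_{i,j}^{(n)}=\sum_{k=1}^n\mathbf{1}\{X_{k,j}\le X_{i,j}\}$. The empirical copula is $$\mathbb{C}_n(\boldsymbol{u})=\frac1n\sum_{i=1}^n\prod_{j=1}^d\mathbf{1}\{R_{i,j}^{(n)}/n\le u_j\},\qquad \boldsymbol{u}\in[0,1]^d.$$ For $f:[0,1]^d\to\mathbb{R}$ and $\boldsymbol{m}\in\mathbb{N}^d$, $$B_{\boldsymbol{m}}(f)(\boldsymbol{u})=\sum_{s_1=0}^{m_1}\cdots\sum_{s_d=0}^{m_d}f(s_1/m_1,\ldots,s_d/m_d)\prod_{j=1}^d p_{m_j,s_j}(u_j),\qquad p_{m,s}(u)=\binom{m}{s}u^s(1-u)^{m-s}.$$ $B_{\boldsymbol{m}}(\mathbb{C}_n)$ is called the empirical Bernstein copula. A copula is (the restriction to $[0,1]^d$ of) the cumulative distribution function of a probability distribution on $[0,1]^d$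 all of whose one-dimensional margins are uniform on $[0,1]$; equivalently, a function $C:[0,1]^d\to[0,1]$ that vanishes when some $u_j=0$, satisfies $C(1,\ldots,1,u_j,1,\ldots,1)=u_j$ for all $j$, and is $d$-increasing (assigns nonnegative volume to every box). *)

theory Defs
  imports "HOL-Probability.Probability"
begin

text \<open>
  Points of the unit cube are vectors in \<^typ>\<open>real ^ 'd\<close>, and the cube itself is \<open>cbox 0 1\<close>.
  Functions on the cube are total functions of which only the values on \<open>cbox 0 1\<close> matter.
  A sample of size \<open>n\<close> is \<open>X 1, \<dots>, X n\<close>.
\<close>

definition sample_rank :: "nat \<Rightarrow> (nat \<Rightarrow> real ^ 'd) \<Rightarrow> nat \<Rightarrow> 'd \<Rightarrow> nat" where
  "sample_rank n X i j = (\<Sum>k=1..n. of_bool (X k $ j \<le> X i $ j))"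

definition no_ties :: "nat \<Rightarrow> (nat \<Rightarrow> real ^ 'd) \<Rightarrow> bool" where
  "no_ties n X \<longleftrightarrow> (\<forall>j. inj_on (\<lambda>i. X i $ j) {1..n})"

definition empirical_copula :: "nat \<Rightarrow> (nat \<Rightarrow> real ^ 'd) \<Rightarrow> real ^ 'd \<Rightarrow> real" where
  "empirical_copula n X u =
     (1 / real n) * (\<Sum>i=1..n. \<Prod>j\<in>UNIV. of_bool (real (sample_rank n X i j) / real n \<le> u $ j))"

text \<open>The iterated sum over \<open>s\<^sub>1, \<dots>, s\<^sub>d\<close> is a single sum over all multi-indices \<open>s\<close>.\<close>

definition bernstein_operator ::
    "('d \<Rightarrow> nat) \<Rightarrow> (real ^ 'd \<Rightarrow> real) \<Rightarrow> real ^ 'd \<Rightarrow> real" where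
  "bernstein_operator m f u =
     (\<Sum>s\<in>(\<Pi>\<^sub>E j\<in>UNIV. {0..m j}).
        f (\<chi> j. real (s j) / real (m j)) * (\<Prod>j\<in>UNIV. Bernstein (m j) (s j) (u $ j)))"

text \<open>
  The order on vectors is componentwise, so \<open>measure M {..u}\<close> is the multivariate cumulative
  distribution function of \<open>M\<close> at \<open>u\<close>.
\<close>

definition is_copula :: "(real ^ 'd \<Rightarrow> real) \<Rightarrow> bool" where
  "is_copula C \<longleftrightarrow>
     (\<exists>M :: (real ^ 'd) measure.
        prob_space M \<and> sets M = sets borel \<and> emeasure M (cbox 0 1) = 1 \<and>
        (\<forall>j. distr M borel (\<lambda>x. x $ j) = uniform_measure lborel {0..1}) \<and>
        (\<forall>u\<in>cbox 0 1. C u = measure M {..u}))"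

end

(* The empirical Bernstein copula equals (1/n) sum_i prod_j G_ij(u_j), where
   G_ij(u) = P(Bin(m_j, u) / m_j >= R_ij / n) is a continuous distribution function on [0,1].
   It is therefore always the distribution function of a mixture of product measures, and it is a
   copula iff its margins are uniform. As the ranks permute {1..n}, the j-th margin is the
   Bernstein polynomial with coefficients floor(n s / m_j) / n, which never exceed the
   coefficients s / m_j of the identity; evaluating at u = 1/2 shows that the two polynomials
   agree iff all coefficients do, and s = 1 gives m_j dvd n. *)
theory Submission
  imports Defs
begin

section \<open>Uniform margins of a copula\<close>

lemma measure_uniform_unit_interval_Iic:
  "measure (uniform_measure lborel {0..1::real}) {..x} = max 0 (min 1 x)"
proof -
  have "{0..1} \<inter> {..x} = {0..min 1 x}" by auto
  then have emeasure: "emeasure (uniform_measure lborel {0..1::real}) {..x} = ennreal (max 0 (min 1 x))"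
    by (cases "0 \<le> x") (auto simp: divide_ennreal_def max_def)
  show ?thesis unfolding measure_def emeasure by (rule enn2real_ennreal) simp
qed

lemma atMost_vec_eq: "{..u :: real ^ 'd} = {v. \<forall>j. v $ j \<le> u $ j}"
  by (auto simp: less_eq_vec_def)

text \<open>Since \<open>M\<close> sits on the cube, the bounds by 1 in the other coordinates hold
  almost surely, so the orthant below \<open>?u\<close> has the mass of a half-space in coordinate
  \<open>j\<close>. This extracts from the existential definition the equation on which necessity
  rests.\<close>

lemma is_copula_margin:
  fixes C :: "real ^ 'd \<Rightarrow> real"
  assumes "is_copula C" "0 \<le> x" "x \<le> 1"
  shows "C (\<chi> k. if k = j then x else 1) = x"
proof -
  let ?u = "(\<chi> k. if k = j then x else 1) :: real ^ 'd"
  obtain M :: "(real ^ 'd) measure" where M: "prob_space M" "sets M = sets borel"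
      "emeasure M (cbox 0 1) = 1"
      "distr M borel (\<lambda>x. x $ j) = uniform_measure lborel {0..1}"
      "\<forall>u\<in>cbox 0 1. C u = measure M {..u}"
    using assms(1) unfolding is_copula_def by blast
  interpret prob_space M by fact
  note M(2)[measurable_cong]
  have [simp]: "space M = UNIV" using sets_eq_imp_space_eq[OF M(2)] by simp
  have AE: "AE y in M. y \<in> cbox 0 1"
    using M(2,3) by (intro AE_prob_1) (simp add: measure_def)
  have "C ?u = measure M {..?u}"
    using M(5) assms(2,3) by (simp add: mem_box_cart)
  also have "\<dots> = measure M {y. y $ j \<le> x}"
  proof (rule finite_measure_eq_AE)
    show "AE y in M. (y \<in> {..?u}) = (y \<in> {y. y $ j \<le> x})"
      using AE by eventually_elim (auto simp: less_eq_vec_def mem_box_cart)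
  qed (auto simp: M(2) atMost_vec_eq)
  also have "\<dots> = measure (distr M borel (\<lambda>y. y $ j)) {..x}"
    by (subst measure_distr) (auto simp: vimage_def)
  also have "\<dots> = x"
    unfolding M(4) using assms(2,3) by (simp add: measure_uniform_unit_interval_Iic)
  finally show ?thesis .
qed

section \<open>Measures on vectors built from one-dimensional distribution functions\<close>

text \<open>Product measures live on functions, copulas on vectors; this map carries the former over
  to the latter.\<close>

lemma borel_measurable_vec_lambda:
  assumes "\<And>j. sets (N j) = sets (borel :: real measure)"
  shows "vec_lambda \<in> borel_measurable (PiM (UNIV :: 'd::finite set) N)"
proof -
  have "(\<lambda>f. f j) \<in> borel_measurable (PiM UNIV N)" for j
    using measurable_component_singleton[of j UNIV N] assms by (simp cong: measurable_cong_sets)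
  then show ?thesis
    by (subst borel_measurable_euclidean_space) (auto simp: Basis_vec_def inner_axis)
qed

text \<open>Clamping the argument extends \<open>F\<close> by 0 to the left and by 1 to the right;
  the extension is monotone and continuous, so it is the distribution function of a
  Lebesgue-Stieltjes measure.\<close>

lemma real_distribution_of_cdf_on_unit_interval:
  fixes F :: "real \<Rightarrow> real"
  assumes mono: "mono_on {0..1} F" and cont: "continuous_on {0..1} F"
    and "F 0 = 0" "F 1 = 1"
  obtains N where "real_distribution N" "\<And>x. emeasure N {..x} = ennreal (F (max 0 (min 1 x)))"
proof -
  let ?G = "\<lambda>x. F (max 0 (min 1 x))"
  have mono_G: "?G x \<le> ?G y" if "x \<le> y" for x y
    using that by (intro mono_onD[OF mono]) auto
  have "continuous_on UNIV ?G"
    by (intro continuous_on_compose2[OF cont] continuous_intros) auto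
  then have cont_G: "continuous (at_right a) ?G" for a
    by (simp add: continuous_on_eq_continuous_at continuous_at_imp_continuous_within)
  have bot: "(?G \<longlongrightarrow> 0) at_bot"
    by (intro tendsto_eventually eventually_mono[OF eventually_le_at_bot[of 0]])
      (simp add: max_def \<open>F 0 = 0\<close>)
  have top: "(?G \<longlongrightarrow> 1) at_top"
    by (intro tendsto_eventually eventually_mono[OF eventually_ge_at_top[of 1]])
      (simp add: min_def \<open>F 1 = 1\<close>)
  show ?thesis
    using real_distribution_interval_measure[OF mono_G cont_G bot top]
      emeasure_interval_measure_Iic[OF mono_G cont_G bot]
    by (rule that)
qed

text \<open>The law of independent coordinates with distribution functions \<open>F j\<close>.
  Half-spaces get their own formula because they are in general not orthants
  \<open>{..u}\<close>.\<close>

lemma product_distribution: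
  fixes F :: "'d::finite \<Rightarrow> real \<Rightarrow> real"
  assumes mono: "\<And>j. mono_on {0..1} (F j)" and cont: "\<And>j. continuous_on {0..1} (F j)"
    and F0: "\<And>j. F j 0 = 0" and F1: "\<And>j. F j 1 = 1"
  obtains M :: "(real ^ 'd) measure" where "prob_space M" "sets M = sets borel"
    "\<And>u. emeasure M {..u} = ennreal (\<Prod>j\<in>UNIV. F j (max 0 (min 1 (u $ j))))"
    "\<And>j x. emeasure M {v. v $ j \<le> x} = ennreal (F j (max 0 (min 1 x)))"
proof -
  have "\<exists>N. real_distribution N \<and> (\<forall>x. emeasure N {..x} = ennreal (F j (max 0 (min 1 x))))" for j
    using real_distribution_of_cdf_on_unit_interval[OF mono cont F0 F1] by metis
  then obtain N where N: "\<And>j. real_distribution (N j)"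
    and emeasure_N: "\<And>j x. emeasure (N j) {..x} = ennreal (F j (max 0 (min 1 x)))"
    by metis
  have sets_N: "sets (N j) = sets borel" for j
    using N real_distribution.events_eq_borel by blast
  have space_N [simp]: "space (N j) = UNIV" for j
    using sets_eq_imp_space_eq[OF sets_N] by simp
  interpret N: prob_space "N j" for j using N real_distribution.axioms(1) by blast
  interpret P: product_prob_space N UNIV ..
  note meas = borel_measurable_vec_lambda[OF sets_N]
  have [simp]: "space (PiM UNIV N) = UNIV" by (simp add: space_PiM PiE_UNIV_domain)
  let ?M = "distr (PiM UNIV N) borel vec_lambda"
  have "prob_space ?M" by (rule P.prob_space_distr[OF meas])
  moreover have "emeasure ?M {..u} = ennreal (\<Prod>j\<in>UNIV. F j (max 0 (min 1 (u $ j))))" for u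
  proof -
    have "emeasure ?M {..u} = emeasure (PiM UNIV N) {f \<in> space (PiM UNIV N). \<forall>j\<in>UNIV. f j \<in> {..u $ j}}"
      by (subst emeasure_distr[OF meas]) (auto simp: atMost_vec_eq vimage_def)
    also have "\<dots> = (\<Prod>j\<in>UNIV. emeasure (N j) {..u $ j})"
      by (rule P.emeasure_PiM_Collect) (auto simp: sets_N)
    also have "\<dots> = ennreal (\<Prod>j\<in>UNIV. F j (max 0 (min 1 (u $ j))))"
      unfolding emeasure_N
      by (rule prod_ennreal) (use mono_onD[OF mono, of 0] F0 in fastforce)
    finally show ?thesis .
  qed
  moreover have "emeasure ?M {v. v $ j \<le> x} = ennreal (F j (max 0 (min 1 x)))" for j x
  proof -
    have "emeasure ?M {v. v $ j \<le> x} = emeasure (PiM UNIV N) {f \<in> space (PiM UNIV N). f j \<in> {..x}}"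
      by (subst emeasure_distr[OF meas]) (auto simp: vimage_def)
    also have "\<dots> = emeasure (N j) {..x}"
      by (rule P.emeasure_PiM_Collect_single) (auto simp: sets_N)
    finally show ?thesis by (simp add: emeasure_N)
  qed
  ultimately show ?thesis by (intro that[of ?M]) auto
qed

text \<open>Draw an index uniformly from \<open>I\<close>, then a point from \<open>M i\<close>: the
  mixture is a monadic bind.\<close>

lemma finite_mixture:
  fixes M :: "'i \<Rightarrow> (real ^ 'd) measure"
  assumes I: "finite I" "I \<noteq> {}"
    and M: "\<And>i. i \<in> I \<Longrightarrow> prob_space (M i)" "\<And>i. i \<in> I \<Longrightarrow> sets (M i) = sets borel"
  obtains N :: "(real ^ 'd) measure" where "prob_space N" "sets N = sets borel"
    "\<And>A. A \<in> sets borel \<Longrightarrow> emeasure N A = (\<Sum>i\<in>I. ennreal (1 / card I) * emeasure (M i) A)"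
proof -
  let ?U = "uniform_count_measure I"
  interpret U: prob_space ?U by (rule prob_space_uniform_count_measure[OF I])
  \<comment> \<open>Every subset of the finite index space is measurable, so only the values of
    \<open>M\<close> have to be checked.\<close>
  have kernel: "M \<in> measurable ?U (subprob_algebra borel)"
    using M by (auto simp: measurable_def space_uniform_count_measure sets_uniform_count_measure
        space_subprob_algebra prob_space_imp_subprob_space)
  have ne: "space ?U \<noteq> {}" using I by (simp add: space_uniform_count_measure)
  have "prob_space (?U \<bind> M)"
    by (rule U.prob_space_bind[OF _ kernel]) (auto simp: M space_uniform_count_measure)
  moreover have "sets (?U \<bind> M) = sets borel"
    by (rule sets_bind_measurable[OF kernel ne])
  moreover have "emeasure (?U \<bind> M) A = (\<Sum>i\<in>I. ennreal (1 / card I) * emeasure (M i) A)"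
    if "A \<in> sets borel" for A
    unfolding emeasure_bind[OF ne kernel that] unfolding uniform_count_measure_def
    using I by (simp add: nn_integral_point_measure_finite)
  ultimately show ?thesis by (rule that)
qed

text \<open>The criterion for sufficiency: the uniform mixture over \<open>I\<close> of the product
  laws with distribution functions \<open>F i j\<close> is the required measure, and
  \<open>margin\<close> makes its margins uniform.\<close>

lemma is_copula_mixture_of_products:
  fixes F :: "'i \<Rightarrow> 'd::finite \<Rightarrow> real \<Rightarrow> real"
  assumes I: "finite I" "I \<noteq> {}"
    and mono: "\<And>i j. i \<in> I \<Longrightarrow> mono_on {0..1} (F i j)"
    and cont: "\<And>i j. i \<in> I \<Longrightarrow> continuous_on {0..1} (F i j)"
    and F0: "\<And>i j. i \<in> I \<Longrightarrow> F i j 0 = 0" and F1: "\<And>i j. i \<in> I \<Longrightarrow> F i j 1 = 1"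
    and margin: "\<And>j x. 0 \<le> x \<Longrightarrow> x \<le> 1 \<Longrightarrow> (\<Sum>i\<in>I. F i j x) / card I = x"
    and C: "\<And>u. u \<in> cbox 0 1 \<Longrightarrow> C u = (\<Sum>i\<in>I. \<Prod>j\<in>UNIV. F i j (u $ j)) / card I"
  shows "is_copula C"
proof -
  \<comment> \<open>Orthants and half-spaces may be bounded outside the cube, whereas
    \<open>F\<close> is controlled only on the unit interval.\<close>
  let ?c = "\<lambda>x. max 0 (min 1 x) :: real"
  let ?P = "\<lambda>i M :: (real ^ 'd) measure. prob_space M \<and> sets M = sets borel \<and>
      (\<forall>u. emeasure M {..u} = ennreal (\<Prod>j\<in>UNIV. F i j (?c (u $ j)))) \<and>
      (\<forall>j x. emeasure M {v. v $ j \<le> x} = ennreal (F i j (?c x)))"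
  have "\<forall>i\<in>I. \<exists>M. ?P i M"
  proof
    fix i assume i: "i \<in> I"
    show "\<exists>M. ?P i M"
      by (rule product_distribution[of "F i", OF mono[OF i] cont[OF i] F0[OF i] F1[OF i]]) blast
  qed
  then obtain M where "\<forall>i\<in>I. ?P i (M i)" by (rule bchoice[THEN exE])
  then have M: "\<And>i. i \<in> I \<Longrightarrow> prob_space (M i)" "\<And>i. i \<in> I \<Longrightarrow> sets (M i) = sets borel"
    and cdf_M: "\<And>i u. i \<in> I \<Longrightarrow> emeasure (M i) {..u} = ennreal (\<Prod>j\<in>UNIV. F i j (?c (u $ j)))"
    and margin_M: "\<And>i j x. i \<in> I \<Longrightarrow> emeasure (M i) {v. v $ j \<le> x} = ennreal (F i j (?c x))"
    by auto
  obtain N :: "(real ^ 'd) measure" where N: "prob_space N" "sets N = sets borel"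
    and emeasure_N: "\<And>A. A \<in> sets borel \<Longrightarrow>
        emeasure N A = (\<Sum>i\<in>I. ennreal (1 / card I) * emeasure (M i) A)"
    by (rule finite_mixture[OF I M]) auto
  interpret prob_space N by fact
  note N(2)[measurable_cong]
  have [simp]: "space N = UNIV" using sets_eq_imp_space_eq[OF N(2)] by simp
  have nonneg: "0 \<le> F i j (?c x)" if "i \<in> I" for i j x
    using mono_onD[OF mono, of i 0 "?c x" j] F0 that by fastforce
  \<comment> \<open>Serves half-spaces and orthants alike; nonnegativity of \<open>f\<close> lets
    the mixture formula pass from \<open>ennreal\<close> to the reals.\<close>
  have meas_N: "measure N A = (\<Sum>i\<in>I. f i) / card I"
    if "A \<in> sets borel" "\<And>i. i \<in> I \<Longrightarrow> 0 \<le> f i" "\<And>i. i \<in> I \<Longrightarrow> emeasure (M i) A = ennreal (f i)"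
    for A f
  proof -
    have "emeasure N A = (\<Sum>i\<in>I. ennreal (1 / card I * f i))"
      unfolding emeasure_N[OF that(1)]
      by (intro sum.cong refl, subst ennreal_mult) (use that in auto)
    also have "\<dots> = ennreal (\<Sum>i\<in>I. 1 / card I * f i)"
      by (rule sum_ennreal) (use that in simp)
    finally show ?thesis
      using that by (simp add: measure_def sum_nonneg sum_divide_distrib)
  qed
  have margin_N: "distr N borel (\<lambda>v. v $ j) = uniform_measure lborel {0..1}" for j
  proof (rule cdf_unique)
    show "real_distribution (distr N borel (\<lambda>v. v $ j))"
      by (intro real_distribution.intro prob_space_distr real_distribution_axioms.intro) auto
    show "real_distribution (uniform_measure lborel {0..1::real})"
      by (intro real_distribution.intro prob_space_uniform_measure real_distribution_axioms.intro) auto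
    show "cdf (distr N borel (\<lambda>v. v $ j)) = cdf (uniform_measure lborel {0..1})"
    proof
      fix x
      have "measure (distr N borel (\<lambda>v. v $ j)) {..x} = measure N {v. v $ j \<le> x}"
        by (subst measure_distr) (auto simp: vimage_def)
      also have "\<dots> = (\<Sum>i\<in>I. F i j (?c x)) / card I"
        by (rule meas_N) (auto simp: nonneg margin_M)
      also have "\<dots> = ?c x" by (rule margin) auto
      finally show "cdf (distr N borel (\<lambda>v. v $ j)) x = cdf (uniform_measure lborel {0..1}) x"
        by (simp add: cdf_def measure_uniform_unit_interval_Iic)
    qed
  qed
  \<comment> \<open>Concentration on the cube follows from the uniform margins, one coordinate at a
    time.\<close>
  have "AE v in N. v $ j \<in> {0..1}" for j
  proof -
    have "AE x in distr N borel (\<lambda>v. v $ j). x \<in> {0..1}"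
      unfolding margin_N by (rule AE_uniform_measureI) auto
    then show ?thesis by (subst (asm) AE_distr_iff) auto
  qed
  then have "AE v in N. \<forall>j\<in>UNIV. v $ j \<in> {0..1}" by (intro AE_finite_allI) auto
  then have "AE v in N. v \<in> cbox 0 1" by (simp add: mem_box_cart)
  then have "emeasure N (cbox 0 1) = 1" by (intro emeasure_eq_1_AE) (auto simp: N(2))
  moreover have "C u = measure N {..u}" if u: "u \<in> cbox 0 1" for u
  proof -
    have clamp: "?c (u $ j) = u $ j" for j using u by (auto simp: mem_box_cart)
    have "measure N {..u} = (\<Sum>i\<in>I. \<Prod>j\<in>UNIV. F i j (?c (u $ j))) / card I"
      by (rule meas_N) (simp add: atMost_vec_eq, simp_all only: cdf_M prod_nonneg nonneg)
    then show ?thesis using C[OF u] unfolding clamp by simp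
  qed
  ultimately show ?thesis unfolding is_copula_def using N margin_N by blast
qed

section \<open>Bernstein polynomials in one variable\<close>

text \<open>A de Casteljau step, obtained from Pascal's rule.\<close>

lemma sum_Bernstein_Suc:
  "(\<Sum>s\<le>Suc m. g s * Bernstein (Suc m) s x) =
     (1 - x) * (\<Sum>s\<le>m. g s * Bernstein m s x) + x * (\<Sum>s\<le>m. g (Suc s) * Bernstein m s x)"
proof -
  have rec: "Bernstein (Suc m) (Suc s) x = x * Bernstein m s x + (1 - x) * Bernstein m (Suc s) x"
    if "s \<le> m" for s
  \<comment> \<open>At \<open>s = m\<close> the second term vanishes with its binomial coefficient;
    below \<open>m\<close> the truncated exponent \<open>m - Suc s\<close> is a true
    difference.\<close>
  proof (cases "s = m")
    case False
    then have "m - s = Suc (m - Suc s)" using that by simp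
    then show ?thesis by (simp add: Bernstein_def algebra_simps)
  qed (simp add: Bernstein_def)
  have "(\<Sum>s\<le>Suc m. g s * Bernstein (Suc m) s x) =
      g 0 * (1 - x) ^ Suc m + (\<Sum>s\<le>m. g (Suc s) * Bernstein (Suc m) (Suc s) x)"
    by (subst sum.atMost_Suc_shift) (simp add: Bernstein_def)
  also have "(\<Sum>s\<le>m. g (Suc s) * Bernstein (Suc m) (Suc s) x) =
      x * (\<Sum>s\<le>m. g (Suc s) * Bernstein m s x) + (1 - x) * (\<Sum>s\<le>m. g (Suc s) * Bernstein m (Suc s) x)"
    unfolding sum_distrib_left sum.distrib[symmetric]
    by (intro sum.cong refl) (simp add: rec distrib_left mult.left_commute)
  \<comment> \<open>The shifted sum loses the term at index 0 and gains one at \<open>Suc m\<close>,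
    which is zero.\<close>
  also have "(\<Sum>s\<le>m. g (Suc s) * Bernstein m (Suc s) x) = (\<Sum>s\<le>m. g s * Bernstein m s x) - g 0 * (1 - x) ^ m"
    using sum.atMost_Suc_shift[of "\<lambda>s. g s * Bernstein m s x" m] by (simp add: Bernstein_def binomial_eq_0)
  finally show ?thesis by (simp add: algebra_simps)
qed

text \<open>Induction on the degree by the de Casteljau step: both lower-degree polynomials
  increase, and as \<open>x\<close> grows, weight moves to the one with shifted, hence larger,
  coefficients.\<close>

lemma mono_on_sum_Bernstein:
  fixes g :: "nat \<Rightarrow> real"
  assumes "mono g"
  shows "mono_on {0..1} (\<lambda>x. \<Sum>s\<le>m. g s * Bernstein m s x)"
  using assms
proof (induction m arbitrary: g)
  case 0
  then show ?case by (simp add: Bernstein_def mono_on_def)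
next
  case (Suc m)
  let ?B = "\<lambda>g x. \<Sum>s\<le>m. g s * Bernstein m s x"
  let ?g' = "\<lambda>s. g (Suc s)"
  have "mono ?g'" using Suc.prems by (simp add: mono_def)
  show ?case unfolding sum_Bernstein_Suc
  proof (rule mono_onI)
    fix x y :: real assume xy: "x \<in> {0..1}" "y \<in> {0..1}" "x \<le> y"
    have "?B g x \<le> ?B g y" "?B ?g' x \<le> ?B ?g' y"
      using Suc.IH[OF Suc.prems] Suc.IH[OF \<open>mono ?g'\<close>] xy by (blast dest: mono_onD)+
    then have "(1 - x) * ?B g x + x * ?B ?g' x \<le> (1 - x) * ?B g y + x * ?B ?g' y"
      using xy by (intro add_mono mult_left_mono) auto
    \<comment> \<open>Weight \<open>y - x\<close> moves from \<open>?B g y\<close> to the larger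
      value \<open>?B ?g' y\<close>.\<close>
    also have "\<dots> \<le> (1 - y) * ?B g y + y * ?B ?g' y"
    proof -
      have "?B g y \<le> ?B ?g' y"
        using Suc.prems xy by (intro sum_mono mult_right_mono Bernstein_nonneg) (auto simp: mono_def)
      then have "0 \<le> (y - x) * (?B ?g' y - ?B g y)" using xy by simp
      then show ?thesis by (simp add: algebra_simps)
    qed
    finally show "(1 - x) * ?B g x + x * ?B ?g' x \<le> (1 - y) * ?B g y + y * ?B ?g' y" .
  qed
qed

lemma sum_Bernstein_0: "(\<Sum>s\<le>m. g s * Bernstein m s 0) = g 0"
proof -
  have "(\<Sum>s\<le>m. g s * Bernstein m s 0) = (\<Sum>s\<le>m. if s = 0 then g s else 0)"
    by (intro sum.cong) (auto simp: Bernstein_def)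
  then show ?thesis by simp
qed

lemma sum_Bernstein_1: "(\<Sum>s\<le>m. g s * Bernstein m s 1) = g m"
proof -
  have "(\<Sum>s\<le>m. g s * Bernstein m s 1) = (\<Sum>s\<le>m. if s = m then g s else 0)"
    by (intro sum.cong) (auto simp: Bernstein_def)
  then show ?thesis by simp
qed

text \<open>This is the mean of a binomial variable divided by \<open>m\<close>.\<close>

lemma sum_index_Bernstein:
  assumes "m \<ge> 1"
  shows "(\<Sum>s\<le>m. real s / real m * Bernstein m s x) = x"
  using assms sum_k_Bernstein[of m x]
  by (simp add: field_simps flip: sum_divide_distrib)

text \<open>Basis polynomials are strictly positive inside the interval, so no cancellation can hide
  a positive coefficient.\<close>

lemma sum_Bernstein_eq_0_iff:
  assumes "\<And>s. s \<le> m \<Longrightarrow> 0 \<le> g s" "0 < x" "x < 1"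
  shows "(\<Sum>s\<le>m. g s * Bernstein m s x) = 0 \<longleftrightarrow> (\<forall>s\<le>m. g s = 0)"
proof -
  have "0 \<le> g s * Bernstein m s x" if "s \<le> m" for s
    using assms that by (simp add: Bernstein_nonneg)
  then have "(\<Sum>s\<le>m. g s * Bernstein m s x) = 0 \<longleftrightarrow> (\<forall>s\<in>{..m}. g s * Bernstein m s x = 0)"
    by (intro sum_nonneg_eq_0_iff) auto
  moreover have "Bernstein m s x \<noteq> 0" if "s \<le> m" for s
    using Bernstein_pos[OF assms(2,3) that] by simp
  ultimately show ?thesis by auto
qed

section \<open>Ranks of a sample without ties\<close>

lemma sample_rank_eq_card: "sample_rank n X i j = card {k\<in>{1..n}. X k $ j \<le> X i $ j}"
  unfolding sample_rank_def
  by (simp add: Int_def)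

text \<open>A larger observation counts at least itself in addition, so its rank is strictly larger;
  an injective self-map of a finite set is onto.\<close>

lemma bij_betw_sample_rank:
  assumes "no_ties n X"
  shows "bij_betw (\<lambda>i. sample_rank n X i j) {1..n} {1..n}"
proof -
  have less: "sample_rank n X i j < sample_rank n X k j"
    if "i \<in> {1..n}" "k \<in> {1..n}" "X i $ j < X k $ j" for i k
    unfolding sample_rank_eq_card
  proof (rule psubset_card_mono)
    show "{l \<in> {1..n}. X l $ j \<le> X i $ j} \<subset> {l \<in> {1..n}. X l $ j \<le> X k $ j}"
    proof (rule psubsetI)
      have "k \<in> {l \<in> {1..n}. X l $ j \<le> X k $ j}" "k \<notin> {l \<in> {1..n}. X l $ j \<le> X i $ j}"
        using that by auto
      then show "{l \<in> {1..n}. X l $ j \<le> X i $ j} \<noteq> {l \<in> {1..n}. X l $ j \<le> X k $ j}" by blast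
    qed (use that in auto)
  qed simp
  have inj: "inj_on (\<lambda>i. sample_rank n X i j) {1..n}"
  proof (rule inj_onI)
    fix i k assume ik: "i \<in> {1..n}" "k \<in> {1..n}" "sample_rank n X i j = sample_rank n X k j"
    then have "X i $ j = X k $ j"
      using less[of i k] less[of k i] by fastforce
    then show "i = k" using assms ik unfolding no_ties_def inj_on_def by blast
  qed
  have "sample_rank n X i j \<in> {1..n}" if "i \<in> {1..n}" for i
  proof -
    have "card {i} \<le> sample_rank n X i j"
      unfolding sample_rank_eq_card by (rule card_mono) (use that in auto)
    moreover have "sample_rank n X i j \<le> card {1..n}"
      unfolding sample_rank_eq_card by (rule card_mono) auto
    ultimately show ?thesis by simp
  qed
  then have "(\<lambda>i. sample_rank n X i j) ` {1..n} = {1..n}"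
    using inj by (intro endo_inj_surj) auto
  with inj show ?thesis by (simp add: bij_betw_def)
qed

section \<open>The empirical Bernstein copula as an average of products\<close>

text \<open>The function \<open>G_ij\<close> of the overview, for rank \<open>r\<close> and degree
  \<open>m\<close>: the Bernstein polynomial of the indicator of [r/n, 1].\<close>

definition bernstein_factor :: "nat \<Rightarrow> nat \<Rightarrow> nat \<Rightarrow> real \<Rightarrow> real" where
  "bernstein_factor n r m x = (\<Sum>s\<le>m. of_bool (real r / real n \<le> real s / real m) * Bernstein m s x)"

text \<open>For each observation the indicator and the basis polynomial both factor over
  coordinates, so the sum over multi-indices becomes a product of one-dimensional sums.\<close>

lemma bernstein_operator_empirical_copula:
  "bernstein_operator m (empirical_copula n X) u =
     (\<Sum>i=1..n. \<Prod>j\<in>UNIV. bernstein_factor n (sample_rank n X i j) (m j) (u $ j)) / n"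
proof -
  let ?b = "\<lambda>i j s. of_bool (real (sample_rank n X i j) / real n \<le> real s / real (m j)) :: real"
  have "bernstein_operator m (empirical_copula n X) u =
      (\<Sum>s\<in>(\<Pi>\<^sub>E j\<in>UNIV. {0..m j}). \<Sum>i=1..n.
         (\<Prod>j\<in>UNIV. ?b i j (s j) * Bernstein (m j) (s j) (u $ j))) / n"
    unfolding bernstein_operator_def empirical_copula_def
    by (simp add: sum_distrib_right prod.distrib sum_divide_distrib del: of_bool_eq_0_iff)
  also have "\<dots> = (\<Sum>i=1..n. \<Sum>s\<in>(\<Pi>\<^sub>E j\<in>UNIV. {0..m j}).
         (\<Prod>j\<in>UNIV. ?b i j (s j) * Bernstein (m j) (s j) (u $ j))) / n"
    by (subst sum.swap) simp
  also have "\<dots> = (\<Sum>i=1..n. \<Prod>j\<in>UNIV. bernstein_factor n (sample_rank n X i j) (m j) (u $ j)) / n"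
    unfolding bernstein_factor_def by (subst prod_sum_PiE) (simp_all add: atLeast0AtMost)
  finally show ?thesis .
qed

lemma bernstein_factor_0: "r \<ge> 1 \<Longrightarrow> n \<ge> 1 \<Longrightarrow> bernstein_factor n r m 0 = 0"
  unfolding bernstein_factor_def sum_Bernstein_0 by (simp add: divide_le_0_iff)

lemma bernstein_factor_1: "r \<le> n \<Longrightarrow> n \<ge> 1 \<Longrightarrow> m \<ge> 1 \<Longrightarrow> bernstein_factor n r m 1 = 1"
  unfolding bernstein_factor_def sum_Bernstein_1 by simp

lemma mono_on_bernstein_factor: "mono_on {0..1} (bernstein_factor n r m)"
proof -
  have "mono (\<lambda>s. of_bool (real r / real n \<le> real s / real m) :: real)"
  proof (rule monoI)
    fix s t :: nat assume "s \<le> t"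
    then have "real s / real m \<le> real t / real m" by (simp add: divide_right_mono)
    then show "of_bool (real r / real n \<le> real s / real m)
        \<le> (of_bool (real r / real n \<le> real t / real m) :: real)" by auto
  qed
  from mono_on_sum_Bernstein[OF this, of m] show ?thesis by (simp add: bernstein_factor_def[abs_def])
qed

lemma continuous_on_bernstein_factor: "continuous_on A (bernstein_factor n r m)"
  unfolding bernstein_factor_def[abs_def] Bernstein_def by (intro continuous_intros)

section \<open>Margins and divisibility\<close>

text \<open>After exchanging the sums, the coefficient at \<open>s\<close> counts the ranks
  \<open>r\<close> with r/n <= s/m.\<close>

lemma sum_bernstein_factor:
  assumes "n \<ge> 1" "m \<ge> 1"
  shows "(\<Sum>r=1..n. bernstein_factor n r m x) = (\<Sum>s\<le>m. real (n * s div m) * Bernstein m s x)"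
proof -
  have count: "(\<Sum>r=1..n. of_bool (real r / real n \<le> real s / real m)) = real (n * s div m)"
    if "s \<le> m" for s
  proof -
    \<comment> \<open>Ensures that the range \<open>{1..n}\<close> does not cut the count
      short.\<close>
    have le: "n * s div m \<le> n"
      using that assms by (metis div_le_mono div_mult_self_is_m mult.commute
          mult_le_mono1 less_le_trans zero_less_one)
    have "real r / real n \<le> real s / real m \<longleftrightarrow> r \<le> n * s div m" for r
    proof -
      have "real r / real n \<le> real s / real m \<longleftrightarrow> real (r * m) \<le> real (n * s)"
        using assms by (simp add: field_simps)
      also have "\<dots> \<longleftrightarrow> r \<le> n * s div m"
        using assms by (simp only: of_nat_le_iff) (simp add: less_eq_div_iff_mult_less_eq)
      finally show ?thesis .
    qed
    then have "(\<Sum>r=1..n. of_bool (real r / real n \<le> real s / real m)) =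
        real (card ({1..n} \<inter> {r. r \<le> n * s div m}))"
      by simp
    also have "{1..n} \<inter> {r. r \<le> n * s div m} = {1..n * s div m}" using le by auto
    finally show ?thesis by simp
  qed
  have "(\<Sum>r=1..n. bernstein_factor n r m x) =
      (\<Sum>s\<le>m. (\<Sum>r=1..n. of_bool (real r / real n \<le> real s / real m)) * Bernstein m s x)"
    unfolding bernstein_factor_def sum_distrib_right by (rule sum.swap)
  also have "\<dots> = (\<Sum>s\<le>m. real (n * s div m) * Bernstein m s x)"
    by (intro sum.cong refl arg_cong2[where f = "(*)"] count) simp
  finally show ?thesis .
qed

lemma mean_bernstein_factor_uniform_iff:
  assumes "n \<ge> 1" "m \<ge> 1"
  shows "(\<forall>x\<in>{0..1}. (\<Sum>r=1..n. bernstein_factor n r m x) / n = x) \<longleftrightarrow> m dvd n"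
proof
  assume "m dvd n"
  then obtain k where k: "n = m * k" by blast
  \<comment> \<open>Under divisibility the floor is exact, leaving a multiple of the
    identity.\<close>
  then have "real (n * s div m) = n * (real s / real m)" for s
    using assms by (simp add: mult.assoc)
  then have "(\<Sum>r=1..n. bernstein_factor n r m x) = n * x" for x :: real
    using sum_bernstein_factor[OF assms] sum_index_Bernstein[OF assms(2)]
    by (simp only: mult.assoc flip: sum_distrib_left)
  then show "\<forall>x\<in>{0..1}. (\<Sum>r=1..n. bernstein_factor n r m x) / n = x" using assms by simp
next
  assume *: "\<forall>x\<in>{0..1}. (\<Sum>r=1..n. bernstein_factor n r m x) / n = x"
  let ?x = "1 / 2 :: real"
  \<comment> \<open>The fractional part of \<open>n * s / m\<close>, hence nonnegative.\<close>
  let ?g = "\<lambda>s. n * (real s / real m) - real (n * s div m)"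
  have g: "0 \<le> ?g s" for s
    using of_nat_div_le_of_nat[of "n * s" m, where 'a = real] by simp
  have "(\<Sum>s\<le>m. ?g s * Bernstein m s ?x) = n * ?x - (\<Sum>s\<le>m. real (n * s div m) * Bernstein m s ?x)"
    using sum_index_Bernstein[OF assms(2), of ?x]
    by (simp add: left_diff_distrib sum_subtractf mult.assoc flip: sum_distrib_left times_divide_eq_right)
  also have "\<dots> = 0"
  proof -
    have "(\<Sum>r=1..n. bernstein_factor n r m ?x) / n = ?x" using * by simp
    then have "(\<Sum>r=1..n. bernstein_factor n r m ?x) = n * ?x"
      using assms(1) by (simp only: divide_eq_eq mult.commute of_nat_eq_0_iff)
    then show ?thesis unfolding sum_bernstein_factor[OF assms] by simp
  qed
  finally have "\<forall>s\<le>m. ?g s = 0"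
    using g by (subst (asm) sum_Bernstein_eq_0_iff) auto
  \<comment> \<open>The index 1 is in range because \<open>m \<ge> 1\<close>; it says that n/m
    equals its floor.\<close>
  from this[rule_format, of 1] have "real n / real m = real (n div m)" using assms by simp
  then have "real n = real (n div m * m)" using assms by (simp add: field_simps)
  then have "n = n div m * m" by linarith
  then show "m dvd n" by (metis dvd_triv_right)
qed

theorem proposition2p5:
  fixes X :: "nat \<Rightarrow> real ^ 'd" and n :: nat and m :: "'d \<Rightarrow> nat"
  assumes "n \<ge> 1"
    and "no_ties n X"
    and "\<And>j. m j \<ge> 1"
  shows "is_copula (bernstein_operator m (empirical_copula n X)) \<longleftrightarrow> (\<forall>j. m j dvd n)"
proof -
  let ?C = "bernstein_operator m (empirical_copula n X)"
  let ?F = "\<lambda>i j. bernstein_factor n (sample_rank n X i j) (m j)"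
  have rank: "1 \<le> sample_rank n X i j" "sample_rank n X i j \<le> n" if "i \<in> {1..n}" for i j
    using bij_betwE[OF bij_betw_sample_rank[OF assms(2)]] that by auto
  \<comment> \<open>Summing over observations is summing over all ranks, so the margins do not
    depend on the sample.\<close>
  have margin: "(\<Sum>i=1..n. ?F i j x) = (\<Sum>r=1..n. bernstein_factor n r (m j) x)" for j x
    by (rule sum.reindex_bij_betw[OF bij_betw_sample_rank[OF assms(2)]])
  show ?thesis
  proof
    assume copula: "is_copula ?C"
    show "\<forall>j. m j dvd n"
    proof
      fix j
      have "(\<Sum>r=1..n. bernstein_factor n r (m j) x) / n = x" if "x \<in> {0..1}" for x
      proof -
        \<comment> \<open>Every factor with \<open>k \<noteq> j\<close> is evaluated at 1, where it
          equals 1 because ranks are at most \<open>n\<close>.\<close>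
        have "(\<Prod>k\<in>UNIV. ?F i k (if k = j then x else 1)) = ?F i j x" if "i \<in> {1..n}" for i
        proof -
          have "(\<Prod>k\<in>UNIV. ?F i k (if k = j then x else 1)) = (\<Prod>k\<in>UNIV. if k = j then ?F i k x else 1)"
            using rank[OF that] assms by (intro prod.cong) (auto simp: bernstein_factor_1)
          then show ?thesis by simp
        qed
        then have "?C (\<chi> k. if k = j then x else 1) = (\<Sum>r=1..n. bernstein_factor n r (m j) x) / n"
          unfolding bernstein_operator_empirical_copula margin[symmetric] by simp
        with is_copula_margin[OF copula, of x j] that show ?thesis by simp
      qed
      then show "m j dvd n"
        using mean_bernstein_factor_uniform_iff[of n "m j"] assms by blast
    qed
  next
    assume dvd: "\<forall>j. m j dvd n"
    show "is_copula ?C"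
    \<comment> \<open>One product law per observation; divisibility enters through the margin
      condition.\<close>
    proof (rule is_copula_mixture_of_products[of "{1..n}" ?F])
      show "(\<Sum>i=1..n. ?F i j x) / card {1..n} = x" if "0 \<le> x" "x \<le> 1" for j x
        using mean_bernstein_factor_uniform_iff[of n "m j"] assms dvd that unfolding margin by simp
    qed (use assms rank in \<open>auto simp: bernstein_factor_0 bernstein_factor_1 mono_on_bernstein_factor
          continuous_on_bernstein_factor bernstein_operator_empirical_copula\<close>)
  qed
qed

end
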